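(* Let $\varphi_{L}(z)=\sqrt{1+z}$ (principal branch) and $\varphi_{Ne}(z)=1+z-z^3/3$ for $z\in\mathbb{D}$. The equation $$\frac{3}{\Gamma(-\frac12)}\sum_{j=0}^\infty\frac{\Gamma(-\frac12+j)}{j!\,(1+j\beta)}-1=0$$ has a unique root $\beta=\beta_L$ in $(0,\infty)$, $\beta_L\approx 0.158374$, and the following holds. If $\beta\ge\beta_L$ and $p:\mathbb{D}\to\mathbb{C}$ is analytic with $p(0)=1$ and $$p(z)+\beta z p'(z)\prec\varphi_{L}(z),$$ then $p(z)\prec\varphi_{Ne}(z)$. Moreover, the estimate on $\beta$ is best possible: for every $\beta$ with $0<\beta<\beta_L$ there is an analytic $p:\mathbb{D}\to\mathbb{C}$ with $p(0)=1$ and $p(z)+\beta zp'(z)\prec\varphi_{L}(z)$ for which $p\prec\varphi_{Ne}$ fails.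
   Context: $\mathbb{D}=\{z\in\mathbb{C}:|z|<1\}$. For $f$ analytic on $\mathbb{D}$ and $g$ univalent (analytic and injective) on $\mathbb{D}$, $f$ is subordinate to $g$, written $f\prec g$ (or $f(z)\prec g(z)$), if and only if $f(0)=g(0)$ and $f(\mathbb{D})\subset g(\mathbb{D})$. The function $\varphi_{Ne}(z)=1+z-z^3/3$ is univalent on $\mathbb{D}$. $\Gamma$ is the (analytically continued) gamma function, so $\Gamma(-\tfrac12)=-2\sqrt{\pi}$. *)

theory Defs
  imports "HOL-Analysis.Analysis"
begin

abbreviation unit_disc :: "complex set" where
  "unit_disc \<equiv> ball 0 1"

definition univalent :: "(complex \<Rightarrow> complex) \<Rightarrow> bool" where
  "univalent g \<longleftrightarrow> g analytic_on unit_disc \<and> inj_on g unit_disc"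

text \<open>The notion is meant for \<open>f\<close> analytic and \<open>g\<close> univalent on the unit disc; these
  standing assumptions are not part of the predicate. The two superordinate functions used
  here are shown to be univalent below.\<close>
definition subordinate :: "(complex \<Rightarrow> complex) \<Rightarrow> (complex \<Rightarrow> complex) \<Rightarrow> bool"
  (infix "\<prec>\<^sub>s" 50) where
  "f \<prec>\<^sub>s g \<longleftrightarrow> f 0 = g 0 \<and> f ` unit_disc \<subseteq> g ` unit_disc"

definition phi_L :: "complex \<Rightarrow> complex" where
  "phi_L z = csqrt (1 + z)"

definition phi_Ne :: "complex \<Rightarrow> complex" where
  "phi_Ne z = 1 + z - z ^ 3 / 3"

definition series_term :: "real \<Rightarrow> nat \<Rightarrow> real" where
  "series_term \<beta> j = Gamma (- 1/2 + real j) / (fact j * (1 + real j * \<beta>))"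

lemma univalent_phi_L: "univalent phi_L"
proof -
  have ne: "1 + z \<notin> \<real>\<^sub>\<le>\<^sub>0" if "z \<in> unit_disc" for z :: complex
  proof
    assume "1 + z \<in> \<real>\<^sub>\<le>\<^sub>0"
    then have "Re z \<le> -1" by (auto simp: complex_nonpos_Reals_iff)
    moreover have "\<bar>Re z\<bar> < 1" using that abs_Re_le_cmod[of z] by simp
    ultimately show False by linarith
  qed
  have "phi_L holomorphic_on unit_disc"
    unfolding phi_L_def [abs_def] using ne by (intro holomorphic_intros) auto
  moreover have "inj_on phi_L unit_disc"
  proof (rule inj_onI)
    fix z w assume "phi_L z = phi_L w"
    then have "(phi_L z)\<^sup>2 = (phi_L w)\<^sup>2" by simp
    then show "z = w" by (simp add: phi_L_def)
  qed
  ultimately show ?thesis by (simp add: univalent_def analytic_on_open)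
qed

lemma univalent_phi_Ne: "univalent phi_Ne"
proof -
  have "phi_Ne holomorphic_on unit_disc"
    unfolding phi_Ne_def [abs_def] by (intro holomorphic_intros) auto
  moreover have "inj_on phi_Ne unit_disc"
  proof (rule inj_onI)
    fix z w assume zw: "z \<in> unit_disc" "w \<in> unit_disc" and eq: "phi_Ne z = phi_Ne w"
    have "(z - w) * (3 - (z * z + z * w + w * w)) = 3 * (phi_Ne z - phi_Ne w)"
      by (simp add: phi_Ne_def algebra_simps power3_eq_cube)
    then have *: "z = w \<or> z * z + z * w + w * w = 3" using eq by auto
    have lt: "cmod (a * b) < 1" if "a \<in> unit_disc" "b \<in> unit_disc" for a b
      using that mult_strict_mono'[of "cmod a" 1 "cmod b" 1] by (simp add: norm_mult)
    have "cmod (z * z + z * w + w * w) \<le> cmod (z * z) + cmod (z * w) + cmod (w * w)"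
      by (meson add_right_mono norm_triangle_ineq order_trans)
    also have "\<dots> < 3"
      using lt[OF zw(1) zw(1)] lt[OF zw] lt[OF zw(2) zw(2)] by linarith
    finally show "z = w" using * by auto
  qed
  ultimately show ?thesis by (simp add: univalent_def analytic_on_open)
qed

lemma summable_series_term:
  assumes "\<beta> \<ge> 0"
  shows "summable (series_term \<beta>)"
proof -
  define a :: "nat \<Rightarrow> real" where "a j = Gamma (real j + 1/2) / fact j" for j
  have apos: "a j > 0" for j by (auto simp: a_def intro!: divide_pos_pos Gamma_real_pos)
  have diff: "a j - a (Suc j) = Gamma (- 1/2 + real (Suc j)) / (2 * fact (Suc j))" for j
  proof -
    have G: "Gamma (real (Suc j) + 1/2) = (real j + 1/2) * Gamma (real j + 1/2)"
      using Gamma_plus1[of "real j + 1/2"]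
      by (simp add: add_ac nonpos_Ints_def)
    have e: "- 1/2 + real (Suc j) = real j + 1/2" by simp
    have alg: "X / F - (x + 1/2) * X / ((x + 1) * F) = X / (2 * ((x + 1) * F))"
      if "F > 0" "x \<ge> 0" for X F x :: real
      using that by (simp add: divide_simps) (simp add: algebra_simps)
    have f: "fact (Suc j) = (real j + 1) * fact j" by (simp add: add_ac)
    show ?thesis unfolding a_def e G f by (rule alg) simp_all
  qed
  have "decseq a"
  proof (rule decseq_SucI)
    fix j
    have "Gamma (- 1/2 + real (Suc j)) > 0" by (rule Gamma_real_pos) simp
    then have "a j - a (Suc j) \<ge> 0" unfolding diff by (intro divide_nonneg_nonneg) auto
    then show "a (Suc j) \<le> a j" by simp
  qed
  then obtain L where "a \<longlonglongrightarrow> L"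
    using apos decseq_convergent[of a 0] less_imp_le by metis
  then have "summable (\<lambda>j. a j - a (Suc j))"
    using telescope_sums' sums_summable by blast
  then have s: "summable (\<lambda>j. 2 * (a j - a (Suc j)))" by (rule summable_mult)
  have "summable (\<lambda>j. series_term \<beta> (Suc j))"
  proof (rule summable_comparison_test'[OF s])
    fix j :: nat
    have g: "Gamma (- 1/2 + real (Suc j)) > 0" by (rule Gamma_real_pos) simp
    have "fact (Suc j) * 1 \<le> fact (Suc j) * (1 + real (Suc j) * \<beta>)"
      using assms by (intro mult_left_mono) auto
    then have "series_term \<beta> (Suc j) \<le> Gamma (- 1/2 + real (Suc j)) / fact (Suc j)"
      unfolding series_term_def using g by (intro divide_left_mono) auto
    moreover have "series_term \<beta> (Suc j) \<ge> 0"
      unfolding series_term_def using g assms by (intro divide_nonneg_nonneg) auto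
    ultimately show "norm (series_term \<beta> (Suc j)) \<le> 2 * (a j - a (Suc j))"
      unfolding diff by simp
  qed
  then show ?thesis by (simp only: summable_Suc_iff)
qed

end

theory Submission
  imports Defs "HOL-Complex_Analysis.Complex_Analysis" "HOL-Real_Asymp.Real_Asymp"
begin

text \<open>
  Write \<open>\<alpha> = 1 / \<beta>\<close> and \<open>\<Psi>\<^sub>\<beta>(z) = \<alpha> \<integral>\<^sub>0\<^sup>1 t powr (\<alpha> - 1) * sqrt (1 - t z) dt\<close> (here \<open>sqrt_average\<close>, given
  by its power series). It solves \<open>\<Psi> + \<beta> z \<Psi>' = sqrt (1 - z)\<close>, and the root equation says
  \<open>\<Psi>\<^sub>\<beta>(1) = 1/3\<close>. The number \<open>1/3\<close> is the cusp \<open>phi_Ne (-1)\<close> of the nephroid.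

  The root. Apart from the constant term \<open>1\<close>, the coefficients of \<open>\<Psi>\<^sub>\<beta>\<close> are negative and shrink in
  absolute value as \<open>\<beta>\<close> grows, so \<open>\<Psi>\<^sub>\<beta>(1)\<close> is strictly increasing in \<open>\<beta>\<close>. It equals
  \<open>\<alpha> Beta(\<alpha>, 3/2)\<close>, whose square is \<open>\<pi>/4\<close> divided by
  \<open>(\<Gamma>(\<alpha> + 3/2) / \<Gamma>(\<alpha> + 1))\<^sup>2\<close>. Bounds for this ratio, obtained from its functional equation and
  log-convexity, are sharp enough to enclose the root (\<open>sqrt_average_one_root\<close>).

  Sufficiency. If \<open>h = p + \<beta> z p'\<close> is subordinate to \<open>sqrt (1 + z)\<close>, Schwarz's lemma gives
  \<open>norm (h z - 1) \<le> 1 - sqrt (1 - norm z)\<close>. Integrating this along rays gives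
  \<open>norm (p z - 1) \<le> 1 - \<Psi>\<^sub>\<beta>(norm z) < 1 - \<Psi>\<^sub>\<beta>(1)\<close> (\<open>solution_bound\<close>), which is at most \<open>2/3\<close> once
  \<open>\<beta>\<close> reaches the root. The disc of radius \<open>2/3\<close> about \<open>1\<close> lies in the nephroid region
  (\<open>disc_subset_phi_Ne_image\<close>).

  Sharpness. For smaller \<open>\<beta>\<close> the function \<open>\<Psi>\<^sub>\<beta>(-z)\<close> takes real values below \<open>1/3\<close> near \<open>z = -1\<close>,
  while all real points of the nephroid region exceed \<open>1/3\<close>
  (\<open>not_subordinate_phi_Ne_example\<close>).
\<close>

section \<open>The averaged square root\<close>

text \<open>
  The coefficients of the power series of \<open>sqrt (1 - z)\<close> at \<open>0\<close>.
\<close>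

definition sqrt_coeff :: "nat \<Rightarrow> real" where
  "sqrt_coeff j = pochhammer (- 1/2) j / fact j"

text \<open>
  For \<open>\<beta> > 0\<close> and \<open>\<alpha> = 1 / \<beta>\<close> this is the series expansion of
  \<open>\<alpha> \<integral>\<^sub>0\<^sup>1 t powr (\<alpha> - 1) * sqrt (1 - t z) dt\<close>, a weighted average of the square root along the
  segment from \<open>1\<close> to \<open>1 - z\<close>. The field is left open because the real function is the
  majorant in the sufficiency part and the complex function is the extremal one.
\<close>

definition sqrt_average :: "real \<Rightarrow> 'a :: {real_normed_field, banach} \<Rightarrow> 'a" where
  "sqrt_average \<beta> z = (\<Sum>j. of_real (sqrt_coeff j / (1 + real j * \<beta>)) * z ^ j)"

lemma sqrt_coeff_0 [simp]: "sqrt_coeff 0 = 1"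
  by (simp add: sqrt_coeff_def)

lemma sqrt_coeff_Suc_neg: "sqrt_coeff (Suc j) < 0"
proof -
  have "pochhammer (- 1/2) (Suc j) = (- 1/2) * pochhammer (1/2 :: real) j"
    by (simp add: pochhammer_rec)
  moreover have "pochhammer (1/2 :: real) j > 0"
    by (rule pochhammer_pos) simp
  ultimately show ?thesis
    unfolding sqrt_coeff_def by (intro divide_neg_pos) auto
qed

lemma minus_half_not_nonpos_Int: "(- 1/2 :: real) \<notin> \<int>\<^sub>\<le>\<^sub>0"
  using fraction_not_in_Ints[where 'a = real, of 2 "-1"] nonpos_Ints_Int by fastforce

lemma Gamma_minus_half_nonzero: "Gamma (- 1/2 :: real) \<noteq> 0"
  using minus_half_not_nonpos_Int by (simp add: Gamma_eq_zero_iff)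

text \<open>
  \<open>pochhammer (-1/2) j = \<Gamma>(-1/2 + j) / \<Gamma>(-1/2)\<close>, so the series of the root equation is
  \<open>\<Gamma>(-1/2)\<close> times the averaged square root at \<open>1\<close>; the equation says that this value is \<open>1/3\<close>.
\<close>

lemma series_term_eq:
  "series_term \<beta> j = Gamma (- 1/2) * (sqrt_coeff j / (1 + real j * \<beta>))"
  unfolding series_term_def sqrt_coeff_def pochhammer_Gamma[OF minus_half_not_nonpos_Int]
  using Gamma_minus_half_nonzero by simp

lemma summable_sqrt_average_coeff:
  assumes "\<beta> \<ge> 0"
  shows "summable (\<lambda>j. sqrt_coeff j / (1 + real j * \<beta>))"
  using summable_series_term[OF assms] Gamma_minus_half_nonzero
  unfolding series_term_eq [abs_def] summable_cmult_iff by blast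

lemma suminf_series_term:
  assumes "\<beta> \<ge> 0"
  shows "(\<Sum>j. series_term \<beta> j) = Gamma (- 1/2) * sqrt_average \<beta> 1"
  unfolding series_term_eq sqrt_average_def
  using suminf_mult[OF summable_sqrt_average_coeff[OF assms], of "Gamma (- 1/2)"] by simp

lemma norm_sqrt_average_coeff_le:
  assumes "\<beta> \<ge> 0"
  shows "norm (sqrt_coeff j / (1 + real j * \<beta>)) \<le> norm (sqrt_coeff j)"
proof -
  have "1 + real j * \<beta> \<ge> 1" using assms by simp
  then show ?thesis by (simp add: divide_le_eq mult_le_cancel_left1)
qed

text \<open>
  All coefficients but the first have the same sign, so convergence at the boundary point \<open>1\<close>
  is already absolute. This is what makes the series continuous up to the boundary.
\<close>

lemma summable_norm_sqrt_coeff: "summable (\<lambda>j. norm (sqrt_coeff j))"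
proof -
  have "summable (\<lambda>j. sqrt_coeff j)" using summable_sqrt_average_coeff[of 0] by simp
  then have "summable (\<lambda>j. - sqrt_coeff (Suc j))"
    by (simp only: summable_minus_iff summable_Suc_iff)
  moreover have "norm (sqrt_coeff (Suc j)) = - sqrt_coeff (Suc j)" for j
    using sqrt_coeff_Suc_neg[of j] by simp
  ultimately have "summable (\<lambda>j. norm (sqrt_coeff (Suc j)))" by simp
  then show ?thesis by (rule summable_Suc_iff[THEN iffD1])
qed

lemma norm_sqrt_average_term_le:
  fixes z :: "'a :: {real_normed_field, banach}"
  assumes "\<beta> \<ge> 0" "norm z \<le> 1"
  shows "norm (of_real (sqrt_coeff j / (1 + real j * \<beta>)) * z ^ j) \<le> norm (sqrt_coeff j)"
proof -
  have "norm (of_real (sqrt_coeff j / (1 + real j * \<beta>)) * z ^ j)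
      = norm (sqrt_coeff j / (1 + real j * \<beta>)) * norm z ^ j"
    by (simp only: norm_mult norm_power norm_of_real real_norm_def)
  also have "\<dots> \<le> norm (sqrt_coeff j) * 1"
    using assms norm_sqrt_average_coeff_le[OF assms(1)]
    by (intro mult_mono power_le_one) auto
  finally show ?thesis by simp
qed

lemma summable_sqrt_average:
  fixes z :: "'a :: {real_normed_field, banach}"
  assumes "\<beta> \<ge> 0" "norm z \<le> 1"
  shows "summable (\<lambda>j. of_real (sqrt_coeff j / (1 + real j * \<beta>)) * z ^ j)"
  by (rule summable_comparison_test'[OF summable_norm_sqrt_coeff])
     (rule norm_sqrt_average_term_le[OF assms])

lemma continuous_on_sqrt_average:
  assumes "\<beta> \<ge> 0"
  shows "continuous_on (cball 0 1) (sqrt_average \<beta> :: 'a :: {real_normed_field, banach} \<Rightarrow> 'a)"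
proof -
  have "uniform_limit (cball 0 1)
          (\<lambda>n (z :: 'a). \<Sum>j<n. of_real (sqrt_coeff j / (1 + real j * \<beta>)) * z ^ j)
          (sqrt_average \<beta>) sequentially"
    unfolding sqrt_average_def [abs_def]
    by (rule Weierstrass_m_test[OF _ summable_norm_sqrt_coeff])
       (use assms in \<open>intro norm_sqrt_average_term_le, auto\<close>)
  then show ?thesis
    by (rule uniform_limit_theorem[rotated])
       (auto intro!: always_eventually continuous_intros simp del: of_real_divide)
qed

lemma sqrt_average_0 [simp]: "sqrt_average \<beta> 0 = 1"
  using powser_zero[of "\<lambda>j. of_real (sqrt_coeff j / (1 + real j * \<beta>))"]
  by (simp add: sqrt_average_def del: of_real_divide)

text \<open>
  Applying \<open>1 + \<beta> z d/dz\<close> multiplies the \<open>j\<close>-th coefficient by \<open>1 + j \<beta>\<close>, which undoes the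
  averaging and leaves the power series of the square root.
\<close>

lemma sqrt_average_has_derivative:
  fixes z :: "'a :: {real_normed_field, banach}"
  assumes "\<beta> \<ge> 0" "norm z < 1"
  defines "D \<equiv> (\<Sum>j. diffs (\<lambda>j. of_real (sqrt_coeff j / (1 + real j * \<beta>))) j * z ^ j)"
  shows "(sqrt_average \<beta> has_field_derivative D) (at z)"
    and "sqrt_average \<beta> z + of_real \<beta> * z * D = (\<Sum>j. of_real (sqrt_coeff j) * z ^ j)"
proof -
  let ?a = "\<lambda>j. of_real (sqrt_coeff j / (1 + real j * \<beta>)) :: 'a"
  have sm: "summable (\<lambda>j. ?a j * w ^ j)" if "norm w < 1" for w :: 'a
    using summable_sqrt_average[OF assms(1), of w] that by simp
  show "(sqrt_average \<beta> has_field_derivative D) (at z)"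
    unfolding sqrt_average_def [abs_def] D_def
    by (rule termdiffs_strong'[OF sm assms(2)])
  have "summable (\<lambda>j. diffs ?a j * z ^ j)"
    by (rule termdiff_converges[OF assms(2) sm])
  then have "(\<lambda>j. z * (diffs ?a j * z ^ j)) sums (z * D)"
    unfolding D_def by (intro sums_mult summable_sums)
  then have "(\<lambda>j. of_nat (Suc j) * ?a (Suc j) * z ^ Suc j) sums (z * D)"
    by (simp add: diffs_def mult_ac)
  then have "(\<lambda>j. of_nat j * ?a j * z ^ j) sums (z * D)"
    by (subst (asm) sums_Suc_iff) simp
  then have "(\<lambda>j. ?a j * z ^ j + of_real \<beta> * (of_nat j * ?a j * z ^ j)) sums
               (sqrt_average \<beta> z + of_real \<beta> * (z * D))"
    unfolding sqrt_average_def by (rule sums_add[OF summable_sums[OF sm[OF assms(2)]] sums_mult])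
  moreover have "?a j * z ^ j + of_real \<beta> * (of_nat j * ?a j * z ^ j)
                   = of_real (sqrt_coeff j) * z ^ j" for j
  proof -
    define x where "x = sqrt_coeff j / (1 + real j * \<beta>)"
    have "1 + real j * \<beta> > 0" using assms(1) by (intro add_pos_nonneg) auto
    then have "sqrt_coeff j = x * (1 + real j * \<beta>)"
      unfolding x_def by simp
    also have "\<dots> = x + \<beta> * (real j * x)" by (simp add: algebra_simps)
    finally have "sqrt_coeff j = x + \<beta> * (real j * x)" .
    then have "of_real (sqrt_coeff j) = (of_real x + of_real \<beta> * (of_nat j * of_real x) :: 'a)"
      by simp
    then show ?thesis unfolding x_def[symmetric] by (simp only: distrib_right mult.assoc)
  qed
  ultimately show "sqrt_average \<beta> z + of_real \<beta> * z * D = (\<Sum>j. of_real (sqrt_coeff j) * z ^ j)"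
    by (simp only: sums_iff mult.assoc)
qed

lemma sqrt_coeff_gbinomial:
  "of_real (sqrt_coeff j) * z ^ j = ((1/2 :: 'a) gchoose j) * (- z) ^ j"
  for z :: "'a :: {real_normed_field, banach}"
proof -
  have "of_real (pochhammer (- 1/2) j) = (pochhammer (- 1/2) j :: 'a)"
    using pochhammer_of_real[of "- 1/2" j, where 'a = 'a] by simp
  then have "of_real (sqrt_coeff j) = (pochhammer (- 1/2) j / fact j :: 'a)"
    unfolding sqrt_coeff_def by simp
  moreover have "(- z) ^ j = (- 1) ^ j * z ^ j" by (rule power_minus)
  moreover have "(- 1) ^ j * (- 1) ^ j = (1 :: 'a)" by (simp flip: power_mult_distrib)
  ultimately show ?thesis
    by (simp add: gbinomial_pochhammer mult.assoc[symmetric])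
qed

lemma csqrt_power_series:
  assumes "norm z < 1"
  shows "(\<Sum>j. of_real (sqrt_coeff j) * z ^ j) = csqrt (1 - z)"
proof -
  have "(\<lambda>j. of_real (sqrt_coeff j) * z ^ j) sums csqrt (1 - z)"
    unfolding sqrt_coeff_gbinomial csqrt_conv_powr
    using gen_binomial_complex[of "- z" "1/2"] assms by simp
  then show ?thesis by (simp add: sums_iff)
qed

lemma sqrt_power_series:
  assumes "\<bar>x\<bar> < 1"
  shows "(\<Sum>j. of_real (sqrt_coeff j) * x ^ j) = sqrt (1 - x)"
proof -
  have "(\<lambda>j. of_real (sqrt_coeff j) * x ^ j) sums sqrt (1 - x)"
    unfolding sqrt_coeff_gbinomial
    using gen_binomial_real[of "- x" "1/2"] assms by (simp add: powr_half_sqrt)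
  then show ?thesis by (simp add: sums_iff)
qed

section \<open>Sharp bounds for a ratio of gamma values\<close>

definition Gamma_ratio :: "real \<Rightarrow> real" where
  "Gamma_ratio x = (Gamma (x + 1) / Gamma (x + 1/2))\<^sup>2"

lemma Gamma_plus1_pos: "x > 0 \<Longrightarrow> Gamma (x + 1) = x * Gamma x" for x :: real
  by (rule Gamma_plus1) (auto elim!: nonpos_Ints_cases)

lemma Gamma_ratio_pos: "x > 0 \<Longrightarrow> Gamma_ratio x > 0"
  unfolding Gamma_ratio_def by (intro zero_less_power divide_pos_pos Gamma_real_pos) auto

lemma Gamma_ratio_plus1:
  assumes "x > 0"
  shows "Gamma_ratio (x + 1) = Gamma_ratio x * ((x + 1) / (x + 1/2))\<^sup>2"
  using assms Gamma_plus1_pos[of "x + 1"] Gamma_plus1_pos[of "x + 1/2"]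
  by (simp add: Gamma_ratio_def add_ac power_mult_distrib power_divide mult.commute)

lemma Gamma_midpoint_le:
  assumes "x > 0" "y > 0"
  shows "(Gamma ((x + y) / 2))\<^sup>2 \<le> Gamma x * Gamma (y :: real)"
proof -
  have g: "Gamma x > 0" "Gamma y > 0" "Gamma ((x + y) / 2) > 0"
    using assms by (auto intro!: Gamma_real_pos)
  have "ln (Gamma ((1 - 1/2) * x + (1/2) * y)) \<le> (1 - 1/2) * ln (Gamma x) + (1/2) * ln (Gamma y)"
    using convex_onD[OF log_convex_Gamma_real, of "1/2" x y] assms by simp
  also have "(1 - 1/2) * x + (1/2) * y = (x + y) / 2" by (simp add: field_simps)
  finally have "ln ((Gamma ((x + y) / 2))\<^sup>2) \<le> ln (Gamma x * Gamma y)"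
    using g by (simp add: ln_mult ln_realpow)
  then show ?thesis using g by (subst (asm) ln_le_cancel_iff) auto
qed

text \<open>
  Log-convexity of \<open>\<Gamma>\<close> at the midpoints of \<open>[x, x + 1]\<close> and \<open>[x + 1/2, x + 3/2]\<close>. The
  bounds are too weak for numerical use, but they identify the ratio up to a factor tending to 1.
\<close>

lemma Gamma_ratio_crude_bounds:
  assumes "x > 0"
  shows "x \<le> Gamma_ratio x" "Gamma_ratio x \<le> x + 1/2"
proof -
  have g: "Gamma x > 0" "Gamma (x + 1/2) > 0" "Gamma (x + 1) > 0"
    using assms by (auto intro!: Gamma_real_pos)
  have "(Gamma (x + 1/2))\<^sup>2 \<le> Gamma x * Gamma (x + 1)"
    using Gamma_midpoint_le[of x "x + 1"] assms by (simp add: field_simps)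
  then have "x * (Gamma (x + 1/2))\<^sup>2 \<le> (Gamma (x + 1))\<^sup>2"
    using assms mult_left_mono[of "(Gamma (x + 1/2))\<^sup>2" "Gamma x * Gamma (x + 1)" x]
    by (simp add: Gamma_plus1_pos power2_eq_square mult_ac)
  then show "x \<le> Gamma_ratio x"
    using g by (simp add: Gamma_ratio_def power_divide pos_le_divide_eq)
  have "(Gamma (x + 1))\<^sup>2 \<le> Gamma (x + 1/2) * Gamma (x + 1/2 + 1)"
  proof -
    have m: "(x + 1/2 + (x + 1/2 + 1)) / 2 = x + 1" by simp
    show ?thesis using Gamma_midpoint_le[of "x + 1/2" "x + 1/2 + 1", unfolded m] assms by simp
  qed
  also have "\<dots> = (x + 1/2) * (Gamma (x + 1/2))\<^sup>2"
    using Gamma_plus1_pos[of "x + 1/2"] assms by (simp add: power2_eq_square)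
  finally show "Gamma_ratio x \<le> x + 1/2"
    using g by (simp add: Gamma_ratio_def power_divide pos_divide_le_eq)
qed

text \<open>
  Together, the next three lemmas are a comparison principle: \<open>Gamma_ratio\<close> satisfies a known
  functional equation under \<open>x \<mapsto> x + 1\<close>. If \<open>u\<close> violates this equation in one direction only, the
  quotient of the two is monotone along \<open>x, x + 1, x + 2, \<dots>\<close>; since it tends to 1, it lies on one
  side of 1 from the start.
\<close>

lemma Gamma_ratio_over_shift_tendsto:
  assumes "x > 0" and u: "\<And>t. t \<ge> x \<Longrightarrow> u t > 0"
    and lim: "(\<lambda>n. (x + real n) / u (x + real n)) \<longlonglongrightarrow> 1"
      "(\<lambda>n. (x + real n + 1/2) / u (x + real n)) \<longlonglongrightarrow> 1"
  shows "(\<lambda>n. Gamma_ratio (x + real n) / u (x + real n)) \<longlonglongrightarrow> 1"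
proof (rule tendsto_sandwich[OF _ _ lim])
  have "x + real n > 0" "x + real n \<ge> x" for n using assms(1) by simp_all
  then show "\<forall>\<^sub>F n in sequentially. (x + real n) / u (x + real n) \<le> Gamma_ratio (x + real n) / u (x + real n)"
    and "\<forall>\<^sub>F n in sequentially. Gamma_ratio (x + real n) / u (x + real n) \<le> (x + real n + 1/2) / u (x + real n)"
    by (auto intro!: always_eventually divide_right_mono Gamma_ratio_crude_bounds less_imp_le[OF u])
qed

lemma Gamma_ratio_le:
  assumes "x > 0" and u: "\<And>t. t \<ge> x \<Longrightarrow> u t > 0"
    and lim: "(\<lambda>n. (x + real n) / u (x + real n)) \<longlonglongrightarrow> 1"
      "(\<lambda>n. (x + real n + 1/2) / u (x + real n)) \<longlonglongrightarrow> 1"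
    and shift: "\<And>t. t \<ge> x \<Longrightarrow> u (t + 1) \<le> u t * ((t + 1) / (t + 1/2))\<^sup>2"
  shows "Gamma_ratio x \<le> u x"
proof -
  have "incseq (\<lambda>n. Gamma_ratio (x + real n) / u (x + real n))"
  proof (rule incseq_SucI)
    fix n
    define t where "t = x + real n"
    have t: "t \<ge> x" "t > 0" using assms(1) by (simp_all add: t_def)
    have "Gamma_ratio t * u (t + 1) \<le> Gamma_ratio t * (u t * ((t + 1) / (t + 1/2))\<^sup>2)"
      using shift[OF t(1)] Gamma_ratio_pos[OF t(2)] by simp
    also have "\<dots> = Gamma_ratio (t + 1) * u t" by (simp add: Gamma_ratio_plus1[OF t(2)])
    finally have "Gamma_ratio t / u t \<le> Gamma_ratio (t + 1) / u (t + 1)"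
      using u[of t] u[of "t + 1"] t by (simp add: divide_simps)
    then show "Gamma_ratio (x + real n) / u (x + real n) \<le> Gamma_ratio (x + real (Suc n)) / u (x + real (Suc n))"
      by (simp add: t_def add_ac)
  qed
  from incseq_le[OF this Gamma_ratio_over_shift_tendsto[OF assms(1) u lim], of 0]
  show ?thesis using u[of x] by simp
qed

lemma Gamma_ratio_ge:
  assumes "x > 0" and u: "\<And>t. t \<ge> x \<Longrightarrow> u t > 0"
    and lim: "(\<lambda>n. (x + real n) / u (x + real n)) \<longlonglongrightarrow> 1"
      "(\<lambda>n. (x + real n + 1/2) / u (x + real n)) \<longlonglongrightarrow> 1"
    and shift: "\<And>t. t \<ge> x \<Longrightarrow> u (t + 1) \<ge> u t * ((t + 1) / (t + 1/2))\<^sup>2"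
  shows "Gamma_ratio x \<ge> u x"
proof -
  have "decseq (\<lambda>n. Gamma_ratio (x + real n) / u (x + real n))"
  proof (rule decseq_SucI)
    fix n
    define t where "t = x + real n"
    have t: "t \<ge> x" "t > 0" using assms(1) by (simp_all add: t_def)
    have "Gamma_ratio (t + 1) * u t = Gamma_ratio t * (u t * ((t + 1) / (t + 1/2))\<^sup>2)"
      by (simp add: Gamma_ratio_plus1[OF t(2)])
    also have "\<dots> \<le> Gamma_ratio t * u (t + 1)"
      using shift[OF t(1)] Gamma_ratio_pos[OF t(2)] by simp
    finally have "Gamma_ratio (t + 1) / u (t + 1) \<le> Gamma_ratio t / u t"
      using u[of t] u[of "t + 1"] t by (simp add: divide_simps)
    then show "Gamma_ratio (x + real (Suc n)) / u (x + real (Suc n)) \<le> Gamma_ratio (x + real n) / u (x + real n)"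
      by (simp add: t_def add_ac)
  qed
  from decseq_ge[OF this Gamma_ratio_over_shift_tendsto[OF assms(1) u lim], of 0]
  show ?thesis using u[of x] by simp
qed

lemma divide_le_divide_cross:
  fixes a b c d :: "'a :: linordered_field"
  assumes "a * d \<le> c * b" "0 < b" "0 < d"
  shows "a / b \<le> c / d"
  using assms by (simp add: pos_divide_le_eq pos_le_divide_eq)

text \<open>
  With \<open>y = x + 1/4\<close> the asymptotic expansion is \<open>y + 1/(32 y) - 9/(2048 y\<^sup>3) + \<dots>\<close>. The upper
  bound stops after the second term; the lower bound below replaces \<open>9/2048\<close> by the larger
  \<open>1/128\<close>, so that the shift inequality becomes a polynomial with positive coefficients.
\<close>

lemma Gamma_ratio_upper:
  assumes "x > 0"
  shows "Gamma_ratio x \<le> (x + 1/4) + 1 / (32 * (x + 1/4))"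
proof (rule Gamma_ratio_le[OF assms])
  show "(\<lambda>n. (x + real n) / (x + real n + 1/4 + 1 / (32 * (x + real n + 1/4)))) \<longlonglongrightarrow> 1"
    by real_asymp
  show "(\<lambda>n. (x + real n + 1/2) / (x + real n + 1/4 + 1 / (32 * (x + real n + 1/4)))) \<longlonglongrightarrow> 1"
    by real_asymp
next
  fix t :: real assume "t \<ge> x"
  then have t: "t > 0" using assms by simp
  show "t + 1/4 + 1 / (32 * (t + 1/4)) > 0" using t by (simp add: add_pos_pos)
  define y where "y = t + 1/4"
  have y: "y > 0" using t by (simp add: y_def)
  have "(y + 1) + 1 / (32 * (y + 1)) \<le> (y + 1 / (32 * y)) * ((y + 3/4) / (y + 1/4))\<^sup>2"
  proof -
    have e: "(y + 1) + 1 / (32 * (y + 1)) = (32 * (y + 1)\<^sup>2 + 1) / (32 * (y + 1))"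
      "y + 1 / (32 * y) = (32 * y\<^sup>2 + 1) / (32 * y)"
      using y by (simp_all add: field_simps power2_eq_square)
    \<comment> \<open>Cleared of denominators, the two sides differ by a positive constant.\<close>
    have "(32 * y\<^sup>2 + 1) * (y + 3/4)\<^sup>2 * (32 * (y + 1))
        - (32 * (y + 1)\<^sup>2 + 1) * (32 * y * (y + 1/4)\<^sup>2) = 18"
      by (simp add: power2_eq_square algebra_simps)
    then have "(32 * (y + 1)\<^sup>2 + 1) * (32 * y * (y + 1/4)\<^sup>2)
        \<le> (32 * y\<^sup>2 + 1) * (y + 3/4)\<^sup>2 * (32 * (y + 1))"
      by linarith
    then show ?thesis
      unfolding e power_divide times_divide_times_eq
      by (rule divide_le_divide_cross) (use y in auto)
  qed
  then show "t + 1 + 1/4 + 1 / (32 * (t + 1 + 1/4))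
      \<le> (t + 1/4 + 1 / (32 * (t + 1/4))) * ((t + 1) / (t + 1/2))\<^sup>2"
    by (simp add: y_def add_ac)
qed

lemma Gamma_ratio_lower:
  assumes "x \<ge> 1"
  shows "Gamma_ratio x \<ge> (x + 1/4) + 1 / (32 * (x + 1/4)) - 1 / (128 * (x + 1/4) ^ 3)"
proof (rule Gamma_ratio_ge)
  show "x > 0" using assms by simp
  show "(\<lambda>n. (x + real n) / (x + real n + 1/4 + 1 / (32 * (x + real n + 1/4))
      - 1 / (128 * (x + real n + 1/4) ^ 3))) \<longlonglongrightarrow> 1"
    by real_asymp
  show "(\<lambda>n. (x + real n + 1/2) / (x + real n + 1/4 + 1 / (32 * (x + real n + 1/4))
      - 1 / (128 * (x + real n + 1/4) ^ 3))) \<longlonglongrightarrow> 1"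
    by real_asymp
next
  fix t :: real assume "t \<ge> x"
  then have t: "t \<ge> 1" using assms by simp
  define y where "y = t + 1/4"
  have y: "y > 1" using t by (simp add: y_def)
  have e: "y + 1 / (32 * y) - 1 / (128 * y ^ 3) = (128 * y ^ 4 + 4 * y\<^sup>2 - 1) / (128 * y ^ 3)"
    if "y > 0" for y :: real
    using that by (simp add: field_simps eval_nat_numeral)
  have "128 * y ^ 4 + 4 * y\<^sup>2 - 1 > 0"
  proof -
    have "y ^ 4 > 1" "y\<^sup>2 > 1" using y by (auto intro!: one_less_power)
    then show ?thesis by linarith
  qed
  then show "t + 1/4 + 1 / (32 * (t + 1/4)) - 1 / (128 * (t + 1/4) ^ 3) > 0"
    using e[of y] y by (simp add: y_def)
  have "(y + 1 / (32 * y) - 1 / (128 * y ^ 3)) * ((y + 3/4) / (y + 1/4))\<^sup>2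
      \<le> (y + 1) + 1 / (32 * (y + 1)) - 1 / (128 * (y + 1) ^ 3)"
  proof -
    \<comment> \<open>Cleared of denominators, the two sides differ by a polynomial with positive coefficients.\<close>
    have "(128 * (y + 1) ^ 4 + 4 * (y + 1)\<^sup>2 - 1) * (128 * y ^ 3 * (y + 1/4)\<^sup>2)
        - (128 * y ^ 4 + 4 * y\<^sup>2 - 1) * (y + 3/4)\<^sup>2 * (128 * (y + 1) ^ 3)
        = 72 + 408 * y + 632 * y\<^sup>2 + 448 * y ^ 3 + 224 * y ^ 4"
      by (simp add: eval_nat_numeral algebra_simps)
    moreover have "\<dots> \<ge> 0" using y by simp
    ultimately have "(128 * y ^ 4 + 4 * y\<^sup>2 - 1) * (y + 3/4)\<^sup>2 * (128 * (y + 1) ^ 3)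
        \<le> (128 * (y + 1) ^ 4 + 4 * (y + 1)\<^sup>2 - 1) * (128 * y ^ 3 * (y + 1/4)\<^sup>2)"
      by linarith
    moreover have "y > 0" "y + 1 > 0" using y by auto
    ultimately show ?thesis
      unfolding e[OF \<open>y > 0\<close>] e[OF \<open>y + 1 > 0\<close>] power_divide times_divide_times_eq
      by (intro divide_le_divide_cross) auto
  qed
  then show "t + 1 + 1/4 + 1 / (32 * (t + 1 + 1/4)) - 1 / (128 * (t + 1 + 1/4) ^ 3)
      \<ge> (t + 1/4 + 1 / (32 * (t + 1/4)) - 1 / (128 * (t + 1/4) ^ 3)) * ((t + 1) / (t + 1/2))\<^sup>2"
    by (simp add: y_def add_ac)
qed

section \<open>The critical parameter\<close>

text \<open>
  By the differential equation, \<open>x powr \<alpha>\<close> times the averaged square root is a primitive of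
  \<open>\<alpha> x powr (\<alpha> - 1) * sqrt (1 - x)\<close>, so its increment over \<open>[0, 1]\<close> is Euler's beta integral.
\<close>

lemma sqrt_average_one_eq_Beta:
  assumes "\<alpha> > 0"
  shows "sqrt_average (1 / \<alpha>) 1 = \<alpha> * Beta \<alpha> (3/2)"
proof -
  let ?f = "\<lambda>x. x powr \<alpha> * sqrt_average (1 / \<alpha>) (x :: real)"
  have "((\<lambda>x. \<alpha> * (x powr (\<alpha> - 1) * (1 - x) powr (3/2 - 1))) has_integral (?f 1 - ?f 0)) {0..1}"
  proof (rule fundamental_theorem_of_calculus_interior)
    show "continuous_on {0..1} ?f"
      using assms
      by (intro continuous_on_mult continuous_on_powr' continuous_on_id continuous_on_const
            continuous_on_subset[OF continuous_on_sqrt_average]) auto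
  next
    fix x :: real assume x: "x \<in> {0<..<1}"
    define D where "D = (\<Sum>j. diffs (\<lambda>j. of_real (sqrt_coeff j / (1 + real j * (1 / \<alpha>)))) j * x ^ j)"
    have d: "(sqrt_average (1 / \<alpha>) has_field_derivative D) (at x)"
      and ode: "sqrt_average (1 / \<alpha>) x + of_real (1 / \<alpha>) * x * D = sqrt (1 - x)"
      using sqrt_average_has_derivative[of "1 / \<alpha>" x] assms x sqrt_power_series[of x]
      by (auto simp: D_def)
    have "(?f has_field_derivative
        \<alpha> * x powr (\<alpha> - 1) * sqrt_average (1 / \<alpha>) x + D * x powr \<alpha>) (at x)"
      using x by (auto intro!: derivative_eq_intros d)
    also have "\<alpha> * x powr (\<alpha> - 1) * sqrt_average (1 / \<alpha>) x + D * x powr \<alpha>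
        = \<alpha> * x powr (\<alpha> - 1) * (sqrt_average (1 / \<alpha>) x + of_real (1 / \<alpha>) * x * D)"
      using x assms by (simp add: powr_diff field_simps)
    also have "\<dots> = \<alpha> * (x powr (\<alpha> - 1) * (1 - x) powr (3/2 - 1))"
      unfolding ode using x by (simp add: powr_half_sqrt)
    finally show "(?f has_vector_derivative \<alpha> * (x powr (\<alpha> - 1) * (1 - x) powr (3/2 - 1))) (at x)"
      by (simp add: has_real_derivative_iff_has_vector_derivative)
  qed simp
  moreover have "((\<lambda>x. \<alpha> * (x powr (\<alpha> - 1) * (1 - x) powr (3/2 - 1))) has_integral
      \<alpha> * Beta \<alpha> (3/2)) {0..1}"
    using assms by (intro has_integral_mult_right has_integral_Beta_real) auto
  ultimately have "?f 1 - ?f 0 = \<alpha> * Beta \<alpha> (3/2)" by (rule has_integral_unique)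
  then show ?thesis using assms by simp
qed

lemma sqrt_average_one_pos: "\<alpha> > 0 \<Longrightarrow> sqrt_average (1 / \<alpha>) (1 :: real) > 0"
  by (auto simp: sqrt_average_one_eq_Beta Beta_def
           intro!: mult_pos_pos divide_pos_pos Gamma_real_pos)

lemma sqrt_average_one_squared:
  assumes "\<alpha> > 0"
  shows "(sqrt_average (1 / \<alpha>) 1)\<^sup>2 = (pi / 4) / Gamma_ratio (\<alpha> + 1/2)"
proof -
  have G: "Gamma (3/2 :: real) = sqrt pi / 2"
    using Gamma_plus1_pos[of "1/2"] by (simp add: Gamma_one_half_real)
  have "sqrt_average (1 / \<alpha>) 1 = Gamma (\<alpha> + 1) * (sqrt pi / 2) / Gamma (\<alpha> + 3/2)"
    using assms by (simp add: sqrt_average_one_eq_Beta Beta_def G Gamma_plus1_pos)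
  then show ?thesis
    by (simp add: Gamma_ratio_def power_divide power_mult_distrib add_ac)
qed

text \<open>
  Every coefficient of positive index is negative, and increasing the parameter shrinks it.
\<close>

lemma sqrt_average_one_strict_mono:
  assumes "0 \<le> \<beta>" "\<beta> < \<gamma>"
  shows "sqrt_average \<beta> 1 < (sqrt_average \<gamma> 1 :: real)"
proof -
  let ?d = "\<lambda>j. sqrt_coeff j / (1 + real j * \<gamma>) - sqrt_coeff j / (1 + real j * \<beta>)"
  have s: "summable (\<lambda>j. sqrt_coeff j / (1 + real j * \<beta>))"
    "summable (\<lambda>j. sqrt_coeff j / (1 + real j * \<gamma>))"
    using assms by (auto intro: summable_sqrt_average_coeff)
  have pos: "?d (Suc j) > 0" for j
  proof -
    have lt: "0 < 1 + real (Suc j) * \<beta>" "1 + real (Suc j) * \<beta> < 1 + real (Suc j) * \<gamma>"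
      using assms by (auto intro!: add_pos_nonneg)
    have "sqrt_coeff (Suc j) / (1 + real (Suc j) * \<beta>)
        < sqrt_coeff (Suc j) / (1 + real (Suc j) * \<gamma>)"
      by (rule divide_strict_left_mono_neg[OF lt(2) sqrt_coeff_Suc_neg])
         (rule mult_pos_pos[OF lt(1) less_trans[OF lt]])
    then show ?thesis by simp
  qed
  have "0 \<le> ?d j" for j using pos[of "j - 1"] by (cases j) auto
  then have "0 < (\<Sum>j. ?d j)"
    using pos[of 0] by (intro suminf_pos2[where i = "Suc 0"] summable_diff s) auto
  also have "\<dots> = sqrt_average \<gamma> 1 - sqrt_average \<beta> 1"
    unfolding sqrt_average_def using suminf_diff[OF s(2,1)] by simp
  finally show ?thesis by simp
qed

text \<open>
  Squaring turns the comparison with \<open>1/3\<close> into a comparison of the gamma ratio at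
  \<open>\<alpha> + 1/2 \<approx> 6.8\<close> with \<open>9 \<pi> / 4\<close>. The margin is about \<open>0.00002\<close> at both endpoints of the interval,
  which the two bounds for the ratio just resolve.
\<close>

lemma sqrt_average_one_lower_endpoint: "sqrt_average 0.1583735 (1 :: real) < 1/3"
proof -
  define \<alpha> :: real where "\<alpha> = 1 / 0.1583735"
  have b: "1 / \<alpha> = 0.1583735" by (simp add: \<alpha>_def)
  have a: "\<alpha> > 0" by (simp add: \<alpha>_def)
  have "9 * pi / 4 < Gamma_ratio (\<alpha> + 1/2)"
    using Gamma_ratio_lower[of "\<alpha> + 1/2"] pi_approx
    by (simp add: \<alpha>_def eval_nat_numeral)
  then have "(sqrt_average (1 / \<alpha>) 1)\<^sup>2 < (1/3 :: real)\<^sup>2"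
    using Gamma_ratio_pos[of "\<alpha> + 1/2"] a
    by (simp add: sqrt_average_one_squared[OF a] power_divide divide_simps)
  then show ?thesis unfolding b by (rule power_less_imp_less_base) simp
qed

lemma sqrt_average_one_upper_endpoint: "sqrt_average 0.1583745 (1 :: real) > 1/3"
proof -
  define \<alpha> :: real where "\<alpha> = 1 / 0.1583745"
  have b: "1 / \<alpha> = 0.1583745" by (simp add: \<alpha>_def)
  have a: "\<alpha> > 0" by (simp add: \<alpha>_def)
  have "Gamma_ratio (\<alpha> + 1/2) < 9 * pi / 4"
    using Gamma_ratio_upper[of "\<alpha> + 1/2"] pi_approx
    by (simp add: \<alpha>_def eval_nat_numeral)
  then have "(1/3 :: real)\<^sup>2 < (sqrt_average (1 / \<alpha>) 1)\<^sup>2"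
    using Gamma_ratio_pos[of "\<alpha> + 1/2"] a
    by (simp add: sqrt_average_one_squared[OF a] power_divide divide_simps)
  then show ?thesis
    unfolding b by (rule power_less_imp_less_base) (use sqrt_average_one_pos[OF a] b in simp)
qed

lemma sqrt_average_one_root:
  obtains \<beta>\<^sub>L :: real
  where "0.1583735 \<le> \<beta>\<^sub>L" "\<beta>\<^sub>L \<le> 0.1583745" "sqrt_average \<beta>\<^sub>L 1 = (1/3 :: real)"
proof -
  let ?F = "\<lambda>\<beta>. 1 / \<beta> * Beta (1 / \<beta>) (3/2) :: real"
  have F: "?F \<beta> = sqrt_average \<beta> 1" if "\<beta> > 0" for \<beta>
    using sqrt_average_one_eq_Beta[of "1 / \<beta>"] that by simp
  have "\<exists>\<beta>\<ge>0.1583735. \<beta> \<le> 0.1583745 \<and> ?F \<beta> = 1/3"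
  proof (rule IVT')
    show "continuous_on {0.1583735..0.1583745} ?F"
    proof (intro continuous_at_imp_continuous_on ballI)
      fix \<beta> :: real assume "\<beta> \<in> {0.1583735..0.1583745}"
      then have b: "\<beta> \<noteq> 0" "1 / \<beta> > 0" "1 / \<beta> + 3/2 > 0" by (auto intro!: add_pos_pos)
      then have "1 / \<beta> \<notin> \<int>\<^sub>\<le>\<^sub>0" "1 / \<beta> + 3/2 \<notin> \<int>\<^sub>\<le>\<^sub>0"
        using nonpos_Ints_nonpos by (metis not_le)+
      then show "isCont ?F \<beta>"
        unfolding Beta_def using b by (intro continuous_intros) (auto simp: Gamma_eq_zero_iff)
    qed
    show "?F 0.1583735 \<le> 1/3"
      by (subst F) (use sqrt_average_one_lower_endpoint in simp_all)
    show "1/3 \<le> ?F 0.1583745"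
      by (subst F) (use sqrt_average_one_upper_endpoint in simp_all)
  qed simp
  then show ?thesis using that F by force
qed

lemma sqrt_average_less_sqrt_average:
  assumes "\<beta> \<ge> 0" "0 \<le> x" "x < (1 :: real)"
  shows "sqrt_average \<beta> 1 < sqrt_average \<beta> x"
proof -
  let ?c = "\<lambda>j. sqrt_coeff j / (1 + real j * \<beta>)"
  have s: "summable (\<lambda>j. ?c j * x ^ j)" "summable ?c"
    using summable_sqrt_average[of \<beta> x] summable_sqrt_average[of \<beta> "1 :: real"] assms by auto
  have neg: "?c (Suc j) < 0" for j
    using assms sqrt_coeff_Suc_neg by (intro divide_neg_pos add_pos_nonneg) auto
  have "0 < ?c 1 * x ^ 1 - ?c 1"
    using neg[of 0] assms mult_strict_left_mono_neg[of x 1 "?c 1"] by simp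
  moreover have "0 \<le> ?c j * x ^ j - ?c j" for j
  proof (cases j)
    case (Suc i)
    have "?c j * 1 \<le> ?c j * x ^ j"
      using less_imp_le[OF neg[of i]] assms unfolding Suc by (intro mult_left_mono_neg power_le_one) auto
    then show ?thesis by (simp only: mult_1_right diff_ge_0_iff_ge)
  qed simp
  ultimately have "0 < (\<Sum>j. ?c j * x ^ j - ?c j)"
    by (intro suminf_pos2[where i = 1] summable_diff s)
  also have "\<dots> = sqrt_average \<beta> x - sqrt_average \<beta> 1"
    unfolding sqrt_average_def using suminf_diff[OF s] by simp
  finally show ?thesis by simp
qed

section \<open>Solutions of the differential subordination\<close>

lemma Re_csqrt_one_plus_ge:
  assumes "norm w \<le> 1"
  shows "Re (csqrt (1 + w)) \<ge> sqrt (1 - norm w)"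
proof -
  have "1 - norm w \<le> Re (1 + w)" using abs_Re_le_cmod[of w] by simp
  also have "\<dots> \<le> (norm (1 + w) + Re (1 + w)) / 2"
    using complex_Re_le_cmod[of "1 + w"] by simp
  finally show ?thesis by simp
qed

text \<open>
  The value \<open>-norm w\<close> is the worst one on its circle: \<open>norm (h - 1) * norm (h + 1) = norm w\<close> for
  the root \<open>h\<close> of \<open>1 + w\<close>, and \<open>norm (h + 1)\<close> is at least \<open>1 + sqrt (1 - norm w)\<close>.
\<close>

lemma norm_csqrt_one_plus_minus_1_le:
  assumes "norm w \<le> 1"
  shows "norm (csqrt (1 + w) - 1) \<le> 1 - sqrt (1 - norm w)"
proof -
  define h where "h = csqrt (1 + w)"
  define s where "s = sqrt (1 - norm w)"
  have s: "s \<ge> 0" "s\<^sup>2 = 1 - norm w" using assms by (simp_all add: s_def)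
  have "1 + s \<le> Re (h + 1)" using Re_csqrt_one_plus_ge[OF assms] by (simp add: h_def s_def)
  also have "\<dots> \<le> norm (h + 1)" by (rule complex_Re_le_cmod)
  finally have "norm (h - 1) * (1 + s) \<le> norm (h - 1) * norm (h + 1)"
    by (intro mult_left_mono) auto
  also have "\<dots> = norm (h\<^sup>2 - 1)"
    by (simp add: power2_eq_square algebra_simps flip: norm_mult)
  also have "\<dots> = (1 - s) * (1 + s)"
  proof -
    have "norm (h\<^sup>2 - 1) = 1 - s\<^sup>2" using s by (simp add: h_def)
    then show ?thesis by (simp add: power2_eq_square algebra_simps)
  qed
  finally have "norm (h - 1) \<le> 1 - s" using s(1) by (subst (asm) mult_le_cancel_right) auto
  then show ?thesis by (simp add: h_def s_def)
qed

text \<open>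
  Schwarz's lemma for \<open>h\<^sup>2 - 1\<close>, which maps the disc into itself and fixes \<open>0\<close>.
\<close>

lemma subordinate_phi_L_bound:
  assumes "h holomorphic_on unit_disc" "h \<prec>\<^sub>s phi_L" "norm z < 1"
  shows "norm (h z - 1) \<le> 1 - sqrt (1 - norm z)"
proof -
  define w where "w = (\<lambda>z. (h z)\<^sup>2 - 1)"
  have ex: "\<exists>v. norm v < 1 \<and> h u = csqrt (1 + v)" if "norm u < 1" for u
  proof -
    have "h u \<in> phi_L ` unit_disc" using assms(2) that by (auto simp: subordinate_def)
    then show ?thesis by (auto simp: phi_L_def)
  qed
  have w: "norm (w u) < 1 \<and> h u = csqrt (1 + w u)" if u: "norm u < 1" for u
    using ex[OF u] by (auto simp: w_def)
  have le: "norm (w z) \<le> norm z"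
  proof (rule Schwarz_Lemma(1))
    show "w holomorphic_on unit_disc"
      unfolding w_def by (intro holomorphic_intros assms)
    show "w 0 = 0" using assms(2) by (simp add: w_def subordinate_def phi_L_def)
  qed (use w assms in auto)
  have "norm (h z - 1) \<le> 1 - sqrt (1 - norm (w z))"
    using w[OF assms(3)] norm_csqrt_one_plus_minus_1_le[of "w z"] by (metis less_imp_le)
  also have "\<dots> \<le> 1 - sqrt (1 - norm z)" using le by simp
  finally show ?thesis .
qed

text \<open>
  On the ray through \<open>z\<close> the quantity \<open>t powr \<alpha> * (p (t z) - 1)\<close> has derivative
  \<open>\<alpha> t powr (\<alpha> - 1) * (h (t z) - 1)\<close>, where \<open>h\<close> is the left side of the subordination. Its norm is at most
  \<open>\<alpha> t powr (\<alpha> - 1) * (1 - sqrt (1 - t * norm z))\<close>, the derivative of the same quantity for the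
  averaged square root, and the mean value inequality compares the two at \<open>t = 1\<close>.
\<close>

lemma solution_bound:
  assumes "\<alpha> > 0" and p: "p holomorphic_on unit_disc" "p 0 = 1"
    and sub: "(\<lambda>z. p z + complex_of_real (1 / \<alpha>) * z * deriv p z) \<prec>\<^sub>s phi_L"
    and z: "norm z < 1"
  shows "norm (p z - 1) \<le> 1 - sqrt_average (1 / \<alpha>) (norm z)"
proof -
  define h where "h = (\<lambda>z. p z + complex_of_real (1 / \<alpha>) * z * deriv p z)"
  have h: "h holomorphic_on unit_disc"
    unfolding h_def by (intro holomorphic_intros p) auto
  define S where "S = (sqrt_average (1 / \<alpha>) :: real \<Rightarrow> real)"
  define S' where "S' = (\<lambda>x :: real. \<Sum>j. diffs (\<lambda>j. of_real (sqrt_coeff j / (1 + real j * (1 / \<alpha>)))) j * x ^ j)"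
  let ?f = "\<lambda>t :: real. t powr \<alpha> *\<^sub>R (p (of_real t * z) - 1)"
  let ?g = "\<lambda>t :: real. t powr \<alpha> * (1 - S (t * norm z))"
  have tz: "norm (of_real t * z) < 1" if "t \<in> {0..1}" for t
    using that z mult_left_le_one_le[of "norm z" t] by (simp add: norm_mult)
  have "norm (?f 1 - ?f 0) \<le> ?g 1 - ?g 0"
  proof (rule differentiable_bound_general)
    show "continuous_on {0..1} ?f"
      using assms(1) tz
      by (intro continuous_on_scaleR continuous_on_powr' continuous_on_id continuous_on_const
            continuous_on_diff continuous_on_compose2[OF holomorphic_on_imp_continuous_on[OF p(1)]]
            continuous_on_mult continuous_on_of_real) auto
    show "continuous_on {0..1} ?g"
      unfolding S_def using assms(1) tz
      by (intro continuous_on_mult continuous_on_powr' continuous_on_id continuous_on_const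
            continuous_on_diff continuous_on_compose2[OF continuous_on_sqrt_average])
         (auto simp: abs_mult norm_mult less_imp_le)
  next
    fix t :: real assume t: "0 < t" "t < 1"
    have tz1: "norm (of_real t * z) < 1" using tz[of t] t by simp
    then have x1: "t * norm z < 1" "0 \<le> t * norm z" using t by (simp_all add: norm_mult)
    have dp: "(p has_field_derivative deriv p (of_real t * z)) (at (of_real t * z))"
      using tz1 by (intro holomorphic_derivI[OF p(1)]) auto
    have "((\<lambda>t. of_real t * z) has_vector_derivative z) (at t)"
      using has_vector_derivative_mult_left[OF has_vector_derivative_of_real[OF DERIV_ident], of z]
      by simp
    from field_vector_diff_chain_at[OF this dp]
    have "((\<lambda>t. p (of_real t * z)) has_vector_derivative z * deriv p (of_real t * z)) (at t)"
      by (simp add: o_def)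
    then have "((\<lambda>t. p (of_real t * z) - 1) has_vector_derivative z * deriv p (of_real t * z)) (at t)"
      by (rule has_vector_derivative_diff_const[THEN iffD2])
    moreover have pw: "((\<lambda>t. t powr \<alpha>) has_real_derivative \<alpha> * t powr (\<alpha> - 1)) (at t)"
      using t by (auto intro!: derivative_eq_intros)
    ultimately have "(?f has_vector_derivative (t powr \<alpha> *\<^sub>R (z * deriv p (of_real t * z))
        + (\<alpha> * t powr (\<alpha> - 1)) *\<^sub>R (p (of_real t * z) - 1))) (at t)"
      by (intro has_vector_derivative_scaleR)
    also have "t powr \<alpha> *\<^sub>R (z * deriv p (of_real t * z))
        + (\<alpha> * t powr (\<alpha> - 1)) *\<^sub>R (p (of_real t * z) - 1)
        = (\<alpha> * t powr (\<alpha> - 1)) *\<^sub>R (h (of_real t * z) - 1)"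
    proof -
      have "t powr \<alpha> = t * t powr (\<alpha> - 1)" using t by (simp add: powr_diff)
      then show ?thesis using assms(1)
        by (simp add: h_def scaleR_conv_of_real algebra_simps)
    qed
    finally show "(?f has_vector_derivative (\<alpha> * t powr (\<alpha> - 1)) *\<^sub>R (h (of_real t * z) - 1)) (at t)" .
    have d: "(S has_field_derivative S' (t * norm z)) (at (t * norm z))"
      and ode: "S (t * norm z) + 1 / \<alpha> * (t * norm z) * S' (t * norm z) = sqrt (1 - t * norm z)"
      using sqrt_average_has_derivative[of "1 / \<alpha>" "t * norm z"] assms x1 sqrt_power_series[of "t * norm z"]
      by (auto simp: S_def S'_def)
    have "((\<lambda>t. S (t * norm z)) has_real_derivative S' (t * norm z) * norm z) (at t)"
      by (rule DERIV_chain2[where g = "\<lambda>t. t * norm z", OF d]) (auto intro!: derivative_eq_intros)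
    then have "(?g has_real_derivative \<alpha> * t powr (\<alpha> - 1) * (1 - S (t * norm z))
        + - (S' (t * norm z) * norm z) * t powr \<alpha>) (at t)"
      using t by (auto intro!: derivative_eq_intros)
    also have "\<alpha> * t powr (\<alpha> - 1) * (1 - S (t * norm z)) + - (S' (t * norm z) * norm z) * t powr \<alpha>
        = \<alpha> * t powr (\<alpha> - 1) * (1 - (S (t * norm z) + 1 / \<alpha> * (t * norm z) * S' (t * norm z)))"
    proof -
      have "t powr \<alpha> = t * t powr (\<alpha> - 1)" using t by (simp add: powr_diff)
      then show ?thesis using assms(1) by (simp add: algebra_simps)
    qed
    finally show "(?g has_vector_derivative \<alpha> * t powr (\<alpha> - 1) * (1 - sqrt (1 - t * norm z))) (at t)"
      unfolding ode by (simp add: has_real_derivative_iff_has_vector_derivative)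
    have "norm (h (of_real t * z) - 1) \<le> 1 - sqrt (1 - t * norm z)"
      using subordinate_phi_L_bound[OF h sub[folded h_def] tz1] t by (simp add: norm_mult)
    then show "norm ((\<alpha> * t powr (\<alpha> - 1)) *\<^sub>R (h (of_real t * z) - 1))
        \<le> \<alpha> * t powr (\<alpha> - 1) * (1 - sqrt (1 - t * norm z))"
      using assms(1) t by (simp add: mult_left_mono)
  qed simp
  then show ?thesis using assms(1) by (simp add: S_def)
qed

section \<open>The nephroid region\<close>

text \<open>
  Solving \<open>w = 1 + z - z\<^sup>3 / 3\<close> for \<open>z\<close> means finding a fixed point of \<open>z \<mapsto> (w - 1) + z\<^sup>3 / 3\<close>. When
  \<open>w\<close> is within \<open>2/3\<close> of \<open>1\<close> this map sends the closed unit disc into the open one, so Brouwer's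
  theorem provides a fixed point, and it lies in the open disc.
\<close>

lemma disc_subset_phi_Ne_image: "ball 1 (2/3) \<subseteq> phi_Ne ` unit_disc"
proof
  fix w :: complex assume "w \<in> ball 1 (2/3)"
  then have v: "norm (w - 1) < 2/3" by (simp add: dist_norm norm_minus_commute)
  have bound: "norm ((w - 1) + z ^ 3 / 3) < 1" if "norm z \<le> 1" for z
  proof -
    have "norm ((w - 1) + z ^ 3 / 3) \<le> norm (w - 1) + norm (z ^ 3 / 3)" by (rule norm_triangle_ineq)
    also have "norm (z ^ 3 / 3) \<le> 1/3" using that by (simp add: norm_divide norm_power power_le_one)
    finally show ?thesis using v by simp
  qed
  obtain z where z: "z \<in> cball 0 1" "(w - 1) + z ^ 3 / 3 = z"
    by (rule brouwer[of "cball (0 :: complex) 1" "\<lambda>z. (w - 1) + z ^ 3 / 3"])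
       (auto intro!: continuous_intros less_imp_le[OF bound])
  then have "norm z < 1" using bound[of z] by simp
  moreover have "w = phi_Ne z" using z(2) by (simp add: phi_Ne_def algebra_simps)
  ultimately show "w \<in> phi_Ne ` unit_disc" by auto
qed

text \<open>
  The cusp of the nephroid at \<open>1/3\<close> points inwards, and the region meets the real axis only to
  its right: real values are taken at real points only, and there
  \<open>\<phi>(x) - 1/3 = (x + 1)\<^sup>2 (2 - x) / 3\<close>.
\<close>

lemma phi_Ne_image_real_gt:
  assumes "complex_of_real a \<in> phi_Ne ` unit_disc"
  shows "a > 1/3"
proof -
  obtain z where z: "norm z < 1" "complex_of_real a = phi_Ne z" using assms by auto
  obtain x y where xy: "z = Complex x y" by (cases z)
  have "x\<^sup>2 + y\<^sup>2 < 1" using z(1) by (simp add: xy cmod_def)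
  have "Im (phi_Ne z) = y * (1 - x\<^sup>2 + y\<^sup>2 / 3)"
    by (simp add: phi_Ne_def xy power3_eq_cube power2_eq_square field_simps)
  moreover have "Im (phi_Ne z) = 0" by (simp flip: z(2))
  moreover have "1 - x\<^sup>2 + y\<^sup>2 / 3 > 0"
    using \<open>x\<^sup>2 + y\<^sup>2 < 1\<close> zero_le_power2[of y] by linarith
  ultimately have y: "y = 0" by auto
  then have "\<bar>x\<bar> < 1" using z(1) by (simp add: xy cmod_def)
  have "a = Re (phi_Ne z)" by (simp flip: z(2))
  then have "a - 1/3 = (x + 1)\<^sup>2 * (2 - x) / 3"
    by (simp add: phi_Ne_def xy y power3_eq_cube power2_eq_square field_simps)
  moreover have "(x + 1)\<^sup>2 * (2 - x) / 3 > 0" using \<open>\<bar>x\<bar> < 1\<close> by simp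
  ultimately show ?thesis by simp
qed

section \<open>Sufficiency and sharpness\<close>

lemma subordinate_phi_Ne_if:
  assumes "\<beta> > 0" "sqrt_average \<beta> (1 :: real) \<ge> 1/3"
    and p: "p analytic_on unit_disc" "p 0 = 1"
    and sub: "(\<lambda>z. p z + complex_of_real \<beta> * z * deriv p z) \<prec>\<^sub>s phi_L"
  shows "p \<prec>\<^sub>s phi_Ne"
proof -
  have "p z \<in> phi_Ne ` unit_disc" if "norm z < 1" for z
  proof -
    have "norm (p z - 1) \<le> 1 - sqrt_average \<beta> (norm z)"
      using solution_bound[of "1 / \<beta>" p z] assms that by (simp add: analytic_imp_holomorphic)
    also have "\<dots> < 1 - sqrt_average \<beta> 1"
      using sqrt_average_less_sqrt_average[of \<beta> "norm z"] assms that by simp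
    also have "\<dots> \<le> 2/3" using assms by simp
    finally have "p z \<in> ball 1 (2/3)" by (simp add: dist_norm norm_minus_commute)
    then show ?thesis using disc_subset_phi_Ne_image by blast
  qed
  then show ?thesis using p(2) by (auto simp: subordinate_def phi_Ne_def)
qed

lemma of_real_sqrt_average:
  assumes "\<beta> \<ge> 0" "\<bar>x\<bar> \<le> 1"
  shows "complex_of_real (sqrt_average \<beta> x) = sqrt_average \<beta> (complex_of_real x)"
proof -
  have "summable (\<lambda>j. sqrt_coeff j / (1 + real j * \<beta>) * x ^ j)"
    using summable_sqrt_average[of \<beta> x] assms by simp
  from suminf_of_real[OF this, where 'a = complex] show ?thesis
    by (simp add: sqrt_average_def)
qed

text \<open>
  The extremal function is the averaged square root itself, reflected so that the square root is
  evaluated at \<open>1 + z\<close>: it turns the subordination into an equality. If its image lay in the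
  nephroid region, its values on \<open>(-1, 0]\<close> would all exceed \<open>1/3\<close>, and continuity at \<open>-1\<close> would
  give the value \<open>1/3\<close> or more there.
\<close>

lemma not_subordinate_phi_Ne_example:
  assumes "\<beta> \<ge> 0" "sqrt_average \<beta> (1 :: real) < 1/3"
  defines "p \<equiv> \<lambda>z :: complex. sqrt_average \<beta> (- z)"
  shows "p analytic_on unit_disc" "p 0 = 1"
    and "(\<lambda>z. p z + complex_of_real \<beta> * z * deriv p z) \<prec>\<^sub>s phi_L"
    and "\<not> p \<prec>\<^sub>s phi_Ne"
proof -
  have der: "\<exists>D. (p has_field_derivative D) (at z) \<and>
      p z + complex_of_real \<beta> * z * D = csqrt (1 + z)" if "norm z < 1" for z
  proof -
    define D where "D = (\<Sum>j. diffs (\<lambda>j. of_real (sqrt_coeff j / (1 + real j * \<beta>))) j * (- z) ^ j)"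
    have d: "(sqrt_average \<beta> has_field_derivative D) (at (- z))"
      and ode: "sqrt_average \<beta> (- z) + of_real \<beta> * (- z) * D = csqrt (1 - (- z))"
      using sqrt_average_has_derivative[of \<beta> "- z"] assms(1) that csqrt_power_series[of "- z"]
      by (simp_all add: D_def)
    have "(p has_field_derivative D * (- 1)) (at z)"
      unfolding p_def
      by (rule DERIV_chain2[where g = uminus, OF d]) (auto intro!: derivative_eq_intros)
    then show ?thesis using ode by (intro exI[of _ "D * (- 1)"]) (simp add: p_def)
  qed
  have "p holomorphic_on unit_disc"
    using der by (subst holomorphic_on_open) (simp, auto, blast)
  then show "p analytic_on unit_disc" by (simp add: analytic_on_open)
  show p0: "p 0 = 1" by (simp add: p_def)
  have ode: "p z + complex_of_real \<beta> * z * deriv p z = phi_L z" if "norm z < 1" for z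
    using der[OF that] by (auto simp: phi_L_def dest: DERIV_imp_deriv)
  show "(\<lambda>z. p z + complex_of_real \<beta> * z * deriv p z) \<prec>\<^sub>s phi_L"
    using p0 by (auto simp: subordinate_def ode phi_L_def[of 0])
  show "\<not> p \<prec>\<^sub>s phi_Ne"
  proof
    assume "p \<prec>\<^sub>s phi_Ne"
    then have sub: "p ` unit_disc \<subseteq> phi_Ne ` unit_disc" by (simp add: subordinate_def)
    have gt: "sqrt_average \<beta> x > 1/3" if "x \<in> {0..<1}" for x :: real
    proof -
      have "- complex_of_real x \<in> unit_disc" using that by simp
      then have "p (- of_real x) \<in> phi_Ne ` unit_disc" using sub by blast
      then have "complex_of_real (sqrt_average \<beta> x) \<in> phi_Ne ` unit_disc"
        using of_real_sqrt_average[of \<beta> x] assms(1) that by (simp add: p_def)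
      then show ?thesis by (rule phi_Ne_image_real_gt)
    qed
    have "sqrt_average \<beta> (1 :: real) \<ge> 1/3"
    proof (rule continuous_ge_on_closure[where f = "sqrt_average \<beta>" and S = "{0..<1}"])
      show "continuous_on (closure {0..<1 :: real}) (sqrt_average \<beta>)"
        by (rule continuous_on_subset[OF continuous_on_sqrt_average]) (use assms(1) in auto)
    qed (use gt in \<open>auto simp: less_imp_le\<close>)
    then show False using assms(2) by simp
  qed
qed

theorem theorem3p1:
  shows "\<exists>\<beta>\<^sub>L :: real.
    {\<beta>. 0 < \<beta> \<and> 3 / Gamma (- 1/2) * (\<Sum>j. series_term \<beta> j) - 1 = 0} = {\<beta>\<^sub>L} \<and>
    \<bar>\<beta>\<^sub>L - 0.158374\<bar> \<le> 0.0000005 \<and>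
    (\<forall>\<beta> \<ge> \<beta>\<^sub>L. \<forall>p. p analytic_on unit_disc \<and> p 0 = 1 \<and>
        (\<lambda>z. p z + complex_of_real \<beta> * z * deriv p z) \<prec>\<^sub>s phi_L \<longrightarrow>
        p \<prec>\<^sub>s phi_Ne) \<and>
    (\<forall>\<beta>. 0 < \<beta> \<and> \<beta> < \<beta>\<^sub>L \<longrightarrow>
        (\<exists>p. p analytic_on unit_disc \<and> p 0 = 1 \<and>
          (\<lambda>z. p z + complex_of_real \<beta> * z * deriv p z) \<prec>\<^sub>s phi_L \<and>
          \<not> p \<prec>\<^sub>s phi_Ne))"
proof -
  obtain b :: real where b: "0.1583735 \<le> b" "b \<le> 0.1583745" "sqrt_average b 1 = (1/3 :: real)"
    by (rule sqrt_average_one_root)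
  have "b > 0" using b by simp
  have mono: "sqrt_average \<beta> 1 < (1/3 :: real) \<longleftrightarrow> \<beta> < b" if "\<beta> > 0" for \<beta>
    using sqrt_average_one_strict_mono[of \<beta> b] sqrt_average_one_strict_mono[of b \<beta>] b(3) that \<open>b > 0\<close>
    by (cases \<beta> b rule: linorder_cases) auto
  have eq: "3 / Gamma (- 1/2) * (\<Sum>j. series_term \<beta> j) - 1 = 0 \<longleftrightarrow> \<beta> = b" if "\<beta> > 0" for \<beta>
  proof -
    have "3 / Gamma (- 1/2) * (\<Sum>j. series_term \<beta> j) = 3 * sqrt_average \<beta> 1"
      using that Gamma_minus_half_nonzero by (simp add: suminf_series_term)
    then show ?thesis
      using sqrt_average_one_strict_mono[of \<beta> b] sqrt_average_one_strict_mono[of b \<beta>] b(3) that \<open>b > 0\<close>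
      by (cases \<beta> b rule: linorder_cases) auto
  qed
  show ?thesis
  proof (intro exI[of _ b] conjI allI impI)
    show "{\<beta>. 0 < \<beta> \<and> 3 / Gamma (- 1/2) * (\<Sum>j. series_term \<beta> j) - 1 = 0} = {b}"
      using eq \<open>b > 0\<close> by blast
    show "\<bar>b - 0.158374\<bar> \<le> 0.0000005" by (rule abs_leI) (use b in simp_all)
  next
    fix \<beta> p
    assume "\<beta> \<ge> b" and p: "p analytic_on unit_disc \<and> p 0 = 1 \<and>
        (\<lambda>z. p z + complex_of_real \<beta> * z * deriv p z) \<prec>\<^sub>s phi_L"
    then have "\<beta> > 0" "\<not> sqrt_average \<beta> (1 :: real) < 1/3" using \<open>b > 0\<close> mono[of \<beta>] by auto
    then show "p \<prec>\<^sub>s phi_Ne" using p by (intro subordinate_phi_Ne_if[of \<beta>]) auto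
  next
    fix \<beta> assume "0 < \<beta> \<and> \<beta> < b"
    then have "\<beta> \<ge> 0" "sqrt_average \<beta> (1 :: real) < 1/3" using mono[of \<beta>] by auto
    from not_subordinate_phi_Ne_example[OF this]
    show "\<exists>p. p analytic_on unit_disc \<and> p 0 = 1 \<and>
        (\<lambda>z. p z + complex_of_real \<beta> * z * deriv p z) \<prec>\<^sub>s phi_L \<and> \<not> p \<prec>\<^sub>s phi_Ne" by blast
  qed
qed

end
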